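(* Let $\Gamma$ be a finitely generated group with property $P_{\mathrm{FPP}}$. Then $\operatorname{Gir}(\Gamma)=\infty$.
   Context: Girth: for a finitely generated group $\Gamma$ and a finite generating set $S$, consider words in the formal alphabet $S^{\pm1}$. A word is reduced if no letter is immediately followed by its formal inverse, and cyclically reduced if, in addition, the first and last letters are not formal inverses. $\operatorname{Gir}(\Gamma,S)$ is the smallest length of a nonempty cyclically reduced word representing the identity of $\Gamma$, with $\operatorname{Gir}(\Gamma,S)=\infty$ if no such word exists; $\operatorname{Gir}(\Gamma)=\sup_S\operatorname{Gir}(\Gamma,S)$ over all finite generating sets $S$. A group $\Gamma$ has property $P_{\mathrm{FPP}}$ if, for every finite set $F\subseteq\Gamma\setminus\{e\}$, every $n\in\mathbb N$, and every $\varepsilon>0$, there are a finite set $E\subseteq\Gamma$ and subsets $B_t^+,B_t^-\subseteq\Gamma$, $t\in E$, such that: (1) $|E|\ge n$; (2) the family $\{B_t^+,B_t^-:t\in E\}$ is mutually disjoint; (3) $t(\Gamma\setminus B_t^-)\subseteq B_t^+$ for every $t\in E$; (4) for every $a\in F$, $\left|\left\{(s,t)\in E^2: a(B_t^+\cup B_t^-)\cap(B_s^+\cup B_s^-)\neq\varnothing\right\}\right|<\varepsilon|E|$. *)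

theory Defs
  imports
    Complex_Main
    "HOL-Library.Extended_Nat"
    "HOL-Library.Disjoint_Sets"
    "HOL-Algebra.Generated_Groups"
begin

definition finite_generating_set :: "('a, 'b) monoid_scheme \<Rightarrow> 'a set \<Rightarrow> bool" where
  "finite_generating_set G S \<longleftrightarrow> finite S \<and> S \<subseteq> carrier G \<and> generate G S = carrier G"

definition finitely_generated_group :: "('a, 'b) monoid_scheme \<Rightarrow> bool" where
  "finitely_generated_group G \<longleftrightarrow> group G \<and> (\<exists>S. finite_generating_set G S)"

text \<open>
  A letter of the formal alphabet over \<open>S\<close> is a pair \<open>(s, e)\<close> with \<open>s \<in> S\<close>: it is the symbol \<open>s\<close>
  if \<open>e = True\<close> and the symbol \<open>s\<inverse>\<close> if \<open>e = False\<close>. Letters are compared as symbols, not as group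
  elements: if \<open>s\<close> and its inverse both lie in \<open>S\<close> (for instance if \<open>s\<close> has order 2), the letter
  \<open>(s, False)\<close> is different from the letter \<open>(inv s, True)\<close>.
\<close>

type_synonym 'a letter = "'a \<times> bool"

definition formal_inverse :: "'a letter \<Rightarrow> 'a letter" where
  "formal_inverse x = (fst x, \<not> snd x)"

definition words_over :: "'a set \<Rightarrow> 'a letter list set" where
  "words_over S = lists (S \<times> UNIV)"

definition letter_value :: "('a, 'b) monoid_scheme \<Rightarrow> 'a letter \<Rightarrow> 'a" where
  "letter_value G x = (if snd x then fst x else inv\<^bsub>G\<^esub> (fst x))"

definition word_value :: "('a, 'b) monoid_scheme \<Rightarrow> 'a letter list \<Rightarrow> 'a" where
  "word_value G w = foldr (\<otimes>\<^bsub>G\<^esub>) (map (letter_value G) w) \<one>\<^bsub>G\<^esub>"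

definition reduced :: "'a letter list \<Rightarrow> bool" where
  "reduced w \<longleftrightarrow> successively (\<lambda>x y. y \<noteq> formal_inverse x) w"

definition cyclically_reduced :: "'a letter list \<Rightarrow> bool" where
  "cyclically_reduced w \<longleftrightarrow> reduced w \<and> (w \<noteq> [] \<longrightarrow> hd w \<noteq> formal_inverse (last w))"

text \<open>On \<^typ>\<open>enat\<close> the infimum of a nonempty set is its least element, and the infimum of the
  empty set is \<open>\<infinity>\<close>.\<close>

definition girth_wrt :: "('a, 'b) monoid_scheme \<Rightarrow> 'a set \<Rightarrow> enat" where
  "girth_wrt G S =
     (INF w \<in> {w \<in> words_over S. w \<noteq> [] \<and> cyclically_reduced w \<and> word_value G w = \<one>\<^bsub>G\<^esub>}.
        enat (length w))"

definition girth :: "('a, 'b) monoid_scheme \<Rightarrow> enat" where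
  "girth G = (SUP S \<in> {S. finite_generating_set G S}. girth_wrt G S)"

text \<open>Below, \<open>Bp t\<close> and \<open>Bm t\<close> are the sets \<open>B\<^sub>t\<^sup>+\<close> and \<open>B\<^sub>t\<^sup>-\<close>. They are disjoint as a family
  indexed by \<open>E \<times> {+, -}\<close>, that is, for distinct indices.\<close>

definition P_FPP :: "('a, 'b) monoid_scheme \<Rightarrow> bool" where
  "P_FPP G \<longleftrightarrow>
     (\<forall>F (n :: nat) (\<epsilon> :: real).
        finite F \<and> F \<subseteq> carrier G - {\<one>\<^bsub>G\<^esub>} \<and> \<epsilon> > 0 \<longrightarrow>
        (\<exists>E Bp Bm.
           finite E \<and> E \<subseteq> carrier G \<and>
           (\<forall>t\<in>E. Bp t \<subseteq> carrier G \<and> Bm t \<subseteq> carrier G) \<and>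
           card E \<ge> n \<and>
           disjoint_family_on (\<lambda>(t, positive). if positive then Bp t else Bm t) (E \<times> UNIV) \<and>
           (\<forall>t\<in>E. t <#\<^bsub>G\<^esub> (carrier G - Bm t) \<subseteq> Bp t) \<and>
           (\<forall>a\<in>F. real (card {(s, t). s \<in> E \<and> t \<in> E \<and>
                                (a <#\<^bsub>G\<^esub> (Bp t \<union> Bm t)) \<inter> (Bp s \<union> Bm s) \<noteq> {}})
                  < \<epsilon> * real (card E))))"

end

theory Submission
  imports Defs
begin

text \<open>
  Fix a length \<open>N\<close> and a finite generating set \<open>S\<close>. Apply the property to \<open>F = S - {\<one>}\<close> with
  \<open>n = 2\<close> and \<open>\<epsilon> = 1 / (|F| + 1)\<close>. The bound on the number of bad pairs also bounds the
  number of bad \<^emph>\<open>diagonal\<close> pairs, and these are too few to exhaust \<open>E\<close>. So a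
  single \<open>t \<in> E\<close> is good for all of \<open>F\<close> at once: with \<open>B = B\<^sub>t\<^sup>+ \<union> B\<^sub>t\<^sup>-\<close>, the set \<open>s B\<close> is disjoint
  from \<open>B\<close> for every \<open>s \<in> F\<close> (lemma \<open>P_FPP_displacing_element\<close>). On the other hand every
  nontrivial power of \<open>t\<close> moves the complement of \<open>B\<close> into \<open>B\<close>. This is a ping-pong situation:
  a product in which nonzero powers of \<open>t\<close> alternate with elements of \<open>F\<close> or their inverses is nontrivial if
  it starts and ends with a power of \<open>t\<close>.

  The new generators are \<open>t\<close> and \<open>t\<^sup>m s t\<^sup>m\<close> for \<open>s \<in> F\<close>, where the exponent \<open>m = m(s)\<close> exceeds \<open>N\<close>
  and the exponents of different \<open>s\<close> differ by more than \<open>N\<close>. Expand a reduced word of length at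
  most \<open>N\<close> in these generators. The power of \<open>t\<close> between two consecutive occurrences of elements
  of \<open>F\<close> has exponent \<open>\<plusminus>m(s) \<plusminus> m(s') + r\<close>, where \<open>r\<close> comes from the letters \<open>t\<^sup>\<plusminus>\<^sup>1\<close> in between and
  \<open>|r| < N\<close>. It vanishes only if the two large terms cancel and \<open>r = 0\<close>, that is, if a letter is followed by its
  formal inverse. Hence no nonempty reduced word of length at most \<open>N\<close> is a relation
  (lemma \<open>reduced_word_nontrivial\<close>), and as \<open>N\<close> is arbitrary the girth is infinite.
\<close>

section \<open>Ping-pong for short words\<close>

definition sign :: "bool \<Rightarrow> int" where
  "sign e = (if e then 1 else -1)"

text \<open>
  The generators are \<open>t\<close> and the elements \<open>h = t\<^sup>m s t\<^sup>m\<close> of \<open>H\<close>, with \<open>m = M h\<close> and \<open>s = mid h\<close>. Both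
  are functions of the group element \<open>h\<close>, since formal letters are determined by group elements.
  The point \<open>p\<close> is the one on which relations are tested.
\<close>

locale short_word_ping_pong = group G for G (structure) +
  fixes t p :: 'a and B H :: "'a set" and mid :: "'a \<Rightarrow> 'a" and M :: "'a \<Rightarrow> nat" and N :: nat
  assumes t_carrier: "t \<in> carrier G"
    and p_carrier: "p \<in> carrier G" and p_notin: "p \<notin> B"
    and power_into: "\<And>k::int. \<And>y. k \<noteq> 0 \<Longrightarrow> y \<in> carrier G \<Longrightarrow> y \<notin> B \<Longrightarrow> t [^] k \<otimes> y \<in> B"
    and mid_carrier: "\<And>h. h \<in> H \<Longrightarrow> mid h \<in> carrier G"
    and mid_out: "\<And>h y. h \<in> H \<Longrightarrow> y \<in> carrier G \<Longrightarrow> y \<in> B \<Longrightarrow> mid h \<otimes> y \<notin> B"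
    and sandwich: "\<And>h. h \<in> H \<Longrightarrow> h = t [^] int (M h) \<otimes> mid h \<otimes> t [^] int (M h)"
    and M_large: "\<And>h. h \<in> H \<Longrightarrow> N < M h"
    and M_gap: "\<And>h h'. h \<in> H \<Longrightarrow> h' \<in> H \<Longrightarrow> h \<noteq> h' \<Longrightarrow> int N < \<bar>int (M h) - int (M h')\<bar>"
begin

text \<open>
  Applying a word to \<open>p\<close> gives \<open>t\<close> raised to \<open>run w + carry w\<close>, applied to \<open>pivot w\<close>: here \<open>run\<close>
  counts the initial letters \<open>t\<^sup>\<plusminus>\<^sup>1\<close>, \<open>carry\<close> is the exponent contributed by the left factor \<open>t\<^sup>\<plusminus>\<^sup>m\<close>
  of the first other letter, and \<open>pivot\<close> is the point reached just before that factor is applied.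
\<close>

primrec run :: "'a letter list \<Rightarrow> int" where
  "run [] = 0"
| "run (x # w) = (if fst x = t then sign (snd x) + run w else 0)"

primrec carry :: "'a letter list \<Rightarrow> int" where
  "carry [] = 0"
| "carry (x # w) = (if fst x = t then carry w else sign (snd x) * int (M (fst x)))"

primrec pivot :: "'a letter list \<Rightarrow> 'a" where
  "pivot [] = p"
| "pivot (x # w) =
    (if fst x = t then pivot w
     else letter_value G (mid (fst x), snd x)
          \<otimes> (t [^] (sign (snd x) * int (M (fst x)) + run w + carry w) \<otimes> pivot w))"

lemma letter_value_t: "letter_value G (t, e) = t [^] sign e"
  using t_carrier by (simp add: letter_value_def sign_def int_pow_neg int_pow_1)

lemma letter_value_mid_carrier: "h \<in> H \<Longrightarrow> letter_value G (mid h, e) \<in> carrier G"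
  using mid_carrier by (simp add: letter_value_def)

lemma letter_value_sandwich:
  assumes "h \<in> H"
  shows "letter_value G (h, e) = t [^] (sign e * int (M h)) \<otimes> letter_value G (mid h, e)
           \<otimes> t [^] (sign e * int (M h))"
proof -
  define k s where "k = int (M h)" and "s = mid h"
  have h: "h = t [^] k \<otimes> s \<otimes> t [^] k" and s: "s \<in> carrier G"
    using sandwich[OF assms] mid_carrier[OF assms] by (auto simp only: k_def s_def)
  show ?thesis
    unfolding k_def[symmetric] s_def[symmetric]
    using h s t_carrier
    by (simp add: letter_value_def sign_def inv_mult_group int_pow_neg m_assoc)
qed

text \<open>An inverse of \<open>mid h\<close> that kept a point of \<open>B\<close> inside \<open>B\<close> would give a point that
  \<open>mid h\<close> keeps inside \<open>B\<close>.\<close>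

lemma letter_value_mid_out:
  assumes "h \<in> H" "y \<in> carrier G" "y \<in> B"
  shows "letter_value G (mid h, e) \<otimes> y \<notin> B"
proof (cases e)
  case True
  then show ?thesis using mid_out assms by (simp add: letter_value_def)
next
  case False
  have "mid h \<otimes> (inv (mid h) \<otimes> y) = y"
    using mid_carrier assms by (simp add: m_assoc[symmetric])
  then have "inv (mid h) \<otimes> y \<notin> B"
    using mid_out[of h "inv (mid h) \<otimes> y"] mid_carrier assms by auto
  then show ?thesis using False by (simp add: letter_value_def)
qed

lemma word_value_carrier:
  assumes "w \<in> words_over (insert t H)"
  shows "word_value G w \<in> carrier G"
  using assms
proof (induction w)
  case Nil
  then show ?case by (simp add: word_value_def)
next
  case (Cons x w)
  have x: "fst x \<in> insert t H" and w: "w \<in> words_over (insert t H)"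
    using Cons.prems by (auto simp: words_over_def)
  have "fst x \<in> carrier G"
  proof (cases "fst x = t")
    case True then show ?thesis using t_carrier by simp
  next
    case False
    then have "fst x \<in> H" using x by simp
    then show ?thesis
      using sandwich[of "fst x"] mid_carrier[of "fst x"] t_carrier
      by (metis int_pow_closed m_closed)
  qed
  then show ?case using Cons.IH[OF w] by (simp add: word_value_def letter_value_def)
qed

lemma pivot_carrier:
  assumes "w \<in> words_over (insert t H)"
  shows "pivot w \<in> carrier G"
  using assms p_carrier t_carrier letter_value_mid_carrier
  by (induction w) (auto simp: words_over_def)

lemma word_value_apply:
  assumes "w \<in> words_over (insert t H)"
  shows "word_value G w \<otimes> p = t [^] (run w + carry w) \<otimes> pivot w"
  using assms
proof (induction w)
  case Nil
  then show ?case using p_carrier by (simp add: word_value_def)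
next
  case (Cons x w)
  obtain h e where x: "x = (h, e)" by (cases x)
  have h: "h \<in> insert t H" and w: "w \<in> words_over (insert t H)"
    using Cons.prems x by (auto simp: words_over_def)
  have pw: "pivot w \<in> carrier G" using pivot_carrier[OF w] .
  have lv: "letter_value G (h, e) \<in> carrier G"
    using h
    by (cases "h = t")
      (auto simp: letter_value_t t_carrier letter_value_sandwich letter_value_mid_carrier)
  have "word_value G (x # w) \<otimes> p = letter_value G (h, e) \<otimes> (word_value G w \<otimes> p)"
    using lv word_value_carrier[OF w] p_carrier x by (simp add: word_value_def m_assoc)
  also have "\<dots> = letter_value G (h, e) \<otimes> (t [^] (run w + carry w) \<otimes> pivot w)"
    using Cons.IH[OF w] by simp
  also have "\<dots> = t [^] (run (x # w) + carry (x # w)) \<otimes> pivot (x # w)"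
  proof (cases "h = t")
    case True
    then show ?thesis using x pw t_carrier
      by (simp add: letter_value_t m_assoc[symmetric] int_pow_mult add.assoc)
  next
    case False
    then have hH: "h \<in> H" using h by simp
    show ?thesis
      using False x pw t_carrier letter_value_mid_carrier[OF hH, of e]
      by (simp add: letter_value_sandwich[OF hH] int_pow_mult m_assoc add.assoc)
  qed
  finally show ?case .
qed

lemma reduced_ConsD: "reduced (x # w) \<Longrightarrow> reduced w"
  by (cases w) (auto simp: reduced_def)

text \<open>All initial letters \<open>t\<^sup>\<plusminus>\<^sup>1\<close> of a reduced word carry the same sign, so their exponents do not
  cancel.\<close>

lemma run_sign:
  assumes "reduced w" "w \<noteq> []" "fst (hd w) = t"
  shows "0 < sign (snd (hd w)) * run w"
  using assms
proof (induction w)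
  case Nil
  then show ?case by simp
next
  case (Cons x w)
  show ?case
  proof (cases "w \<noteq> [] \<and> fst (hd w) = t")
    case True
    then obtain y v where w: "w = y # v" by (cases w) auto
    have "0 < sign (snd y) * run w"
      using Cons.IH reduced_ConsD[OF Cons.prems(1)] True w by simp
    moreover have "snd y = snd x"
      using Cons.prems(1,3) True w by (auto simp: reduced_def formal_inverse_def prod_eq_iff)
    ultimately show ?thesis using Cons.prems(3) w
      by (auto simp: sign_def split: if_splits)
  next
    case False
    then have "run w = 0" by (cases w) auto
    then show ?thesis using Cons.prems(3) by (simp add: sign_def)
  qed
qed

lemma abs_run_le: "\<bar>run w\<bar> \<le> int (length w)"
  by (induction w) (auto simp: sign_def)

lemma carry_cases:
  assumes "w \<in> words_over (insert t H)"
  obtains "carry w = 0" "w \<noteq> [] \<Longrightarrow> fst (hd w) = t"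
  | h e where "h \<in> H" "carry w = sign e * int (M h)"
      "fst (hd w) \<noteq> t \<Longrightarrow> hd w = (h, e)" "w \<noteq> []" "\<bar>run w\<bar> < int (length w)"
proof -
  have "(carry w = 0 \<and> (w \<noteq> [] \<longrightarrow> fst (hd w) = t)) \<or>
    (\<exists>h e. h \<in> H \<and> carry w = sign e * int (M h) \<and> (fst (hd w) \<noteq> t \<longrightarrow> hd w = (h, e))
      \<and> w \<noteq> [] \<and> \<bar>run w\<bar> < int (length w))"
    using assms
  proof (induction w)
    case Nil
    then show ?case by simp
  next
    case (Cons x w)
    obtain h e where x: "x = (h, e)" by (cases x)
    have h: "h \<in> insert t H" and w: "w \<in> words_over (insert t H)"
      using Cons.prems x by (auto simp: words_over_def)
    show ?case
    proof (cases "h = t")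
      case True
      from Cons.IH[OF w] consider "carry w = 0"
        | h' e' where "h' \<in> H" "carry w = sign e' * int (M h')" "\<bar>run w\<bar> < int (length w)"
        by blast
      then show ?thesis
      proof cases
        case 1
        then show ?thesis using True x by simp
      next
        case 2
        have "\<bar>run (x # w)\<bar> < int (length (x # w))"
          using 2(3) True x by (auto simp: sign_def)
        then show ?thesis
          using 2(1,2) True x by (intro disjI2 exI[of _ h'] exI[of _ e']) simp
      qed
    next
      case False
      then show ?thesis using h x by auto
    qed
  qed
  then show ?thesis using that by blast
qed

lemma exponent_nonzero:
  assumes "reduced w" "w \<in> words_over (insert t H)" "w \<noteq> []" "length w \<le> N"
  shows "run w + carry w \<noteq> 0"
  using assms(2)
proof (cases rule: carry_cases)
  case 1
  then show ?thesis using run_sign[OF assms(1,3)] assms(3) by auto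
next
  case (2 h e)
  then show ?thesis using M_large[of h] assms(4) by (auto simp: sign_def)
qed

text \<open>This is where reducedness and the choice of the exponents \<open>M\<close> enter: the large terms
  can cancel only between a letter and its formal inverse, and then the \<open>t\<close>-letters that
  separate the two leave a nonzero remainder.\<close>

lemma joint_exponent_nonzero:
  assumes red: "reduced ((h, e) # w)" and w: "w \<in> words_over (insert t H)"
    and h: "h \<in> H" and len: "length w \<le> N"
  shows "sign e * int (M h) + run w + carry w \<noteq> 0"
  using w
proof (cases rule: carry_cases)
  case 1
  then show ?thesis using abs_run_le[of w] M_large[OF h] len by (auto simp: sign_def)
next
  case (2 h' e')
  have r: "\<bar>run w\<bar> \<le> int N" using 2(5) len by simp
  consider "h \<noteq> h'" | "h = h'" "e = e'" | "h = h'" "e' = (\<not> e)" by blast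
  then show ?thesis
  proof cases
    case 1
    then show ?thesis
      using M_gap[OF h 2(1)] M_large[OF h] M_large[OF 2(1)] 2(2) r by (auto simp: sign_def)
  next
    case 2
    then show ?thesis
      using \<open>carry w = _\<close> M_large[OF h] r by (auto simp: sign_def)
  next
    case 3
    have "fst (hd w) = t"
    proof (rule ccontr)
      assume "fst (hd w) \<noteq> t"
      then have "hd w = formal_inverse (h, e)" using 2(3) 3 by (simp add: formal_inverse_def)
      then show False using red 2(4) by (cases w) (auto simp: reduced_def)
    qed
    then have "run w \<noteq> 0" using run_sign[OF reduced_ConsD[OF red] 2(4)] by auto
    then show ?thesis using 3 2(2) by (auto simp: sign_def)
  qed
qed

lemma pivot_notin:
  assumes "reduced w" "w \<in> words_over (insert t H)" "length w \<le> N"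
  shows "pivot w \<notin> B"
  using assms
proof (induction w)
  case Nil
  then show ?case using p_notin by simp
next
  case (Cons x w)
  obtain h e where x: "x = (h, e)" by (cases x)
  have h: "h \<in> insert t H" and w: "w \<in> words_over (insert t H)"
    using Cons.prems x by (auto simp: words_over_def)
  have out: "pivot w \<notin> B"
    using Cons.IH[OF reduced_ConsD[OF Cons.prems(1)] w] Cons.prems(3) by simp
  show ?case
  proof (cases "h = t")
    case True
    then show ?thesis using out x by simp
  next
    case False
    then have hH: "h \<in> H" using h by simp
    let ?k = "sign e * int (M h) + run w + carry w"
    have "?k \<noteq> 0"
      using joint_exponent_nonzero[OF _ w hH] Cons.prems x by simp
    then have "t [^] ?k \<otimes> pivot w \<in> B"
      using power_into pivot_carrier[OF w] out by blast
    then show ?thesis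
      using letter_value_mid_out[OF hH] pivot_carrier[OF w] t_carrier False x by simp
  qed
qed

text \<open>The leftmost power of \<open>t\<close> has a nonzero exponent and acts last,
  on a point outside \<open>B\<close>. So the word moves \<open>p\<close> into \<open>B\<close>.\<close>

lemma reduced_word_nontrivial:
  assumes "reduced w" "w \<in> words_over (insert t H)" "w \<noteq> []" "length w \<le> N"
  shows "word_value G w \<noteq> \<one>"
proof
  assume "word_value G w = \<one>"
  then have "p = t [^] (run w + carry w) \<otimes> pivot w"
    using word_value_apply[OF assms(2)] p_carrier by simp
  then show False
    using power_into[OF exponent_nonzero[OF assms] pivot_carrier[OF assms(2)]
        pivot_notin[OF assms(1,2,4)]] p_notin
    by metis
qed

end

section \<open>An element displaced by all generators at once\<close>

text \<open>The hypothesis on \<open>t\<close> has a mirror image: \<open>inv t\<close> moves the complement of \<open>P\<close> into \<open>Q\<close>. As \<open>P\<close>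
  lies outside \<open>Q\<close>, a point that \<open>t\<close> has moved into \<open>P\<close> stays there under further applications of
  \<open>t\<close>, and likewise for \<open>inv t\<close> and \<open>Q\<close>.\<close>

lemma (in group) ping_pong_power:
  assumes t: "t \<in> carrier G" and P: "P \<subseteq> carrier G" and Q: "Q \<subseteq> carrier G"
    and disj: "P \<inter> Q = {}" and tP: "t <# (carrier G - Q) \<subseteq> P"
    and k: "k \<noteq> (0::int)" and y: "y \<in> carrier G" "y \<notin> P \<union> Q"
  shows "t [^] k \<otimes> y \<in> P \<union> Q"
proof -
  have forward: "t \<otimes> z \<in> P" if "z \<in> carrier G" "z \<notin> Q" for z
    using tP that by (auto simp: l_coset_def)
  have backward: "inv t \<otimes> z \<in> Q" if z: "z \<in> carrier G" "z \<notin> P" for z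
  proof (rule ccontr)
    assume "inv t \<otimes> z \<notin> Q"
    then have "t \<otimes> (inv t \<otimes> z) \<in> P" using forward z t by simp
    then show False using z t by (simp add: m_assoc[symmetric])
  qed
  have pos: "t [^] Suc n \<otimes> y \<in> P" for n
  proof (induction n)
    case 0
    then show ?case using forward y t by simp
  next
    case (Suc n)
    have "t [^] Suc (Suc n) \<otimes> y = t \<otimes> (t [^] Suc n \<otimes> y)"
      using t y nat_pow_Suc2[OF t, of "Suc n"] by (simp add: m_assoc del: nat_pow_Suc)
    then show ?case using forward Suc disj P by auto
  qed
  have neg: "inv t [^] Suc n \<otimes> y \<in> Q" for n
  proof (induction n)
    case 0
    then show ?case using backward y t by simp
  next
    case (Suc n)
    have "inv t [^] Suc (Suc n) \<otimes> y = inv t \<otimes> (inv t [^] Suc n \<otimes> y)"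
      using t y nat_pow_Suc2[of "inv t" "Suc n"] by (simp add: m_assoc del: nat_pow_Suc)
    then show ?case using backward Suc disj Q by auto
  qed
  show ?thesis
  proof (cases "0 < k")
    case True
    then obtain n where "k = int (Suc n)" by (metis pos_int_cases gr0_implies_Suc)
    then show ?thesis using pos[of n] by (simp only: int_pow_int) simp
  next
    case False
    then have "0 < - k" using k by simp
    then obtain n where "- k = int (Suc n)" by (metis pos_int_cases gr0_implies_Suc)
    then have "k = - int (Suc n)" by simp
    then have "t [^] k = inv t [^] Suc n"
      using t by (simp only: int_pow_neg_int nat_pow_inv)
    then show ?thesis using neg[of n] by simp
  qed
qed

text \<open>If every \<open>t \<in> E\<close> were bad for some \<open>a \<in> F\<close>, the diagonal pairs alone would number at least
  \<open>|E|\<close>, whereas there are at most \<open>|F| / (|F| + 1) \<sqdot> |E|\<close> of them. A second element of \<open>E\<close>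
  guarantees that \<open>B\<close> is not the whole group.\<close>

lemma P_FPP_displacing_element:
  fixes G (structure)
  assumes "group G" "P_FPP G" "finite F" "F \<subseteq> carrier G - {\<one>}"
  obtains t B p where "t \<in> carrier G" "p \<in> carrier G" "p \<notin> B"
    "\<And>k::int. \<And>y. k \<noteq> 0 \<Longrightarrow> y \<in> carrier G \<Longrightarrow> y \<notin> B \<Longrightarrow> t [^] k \<otimes> y \<in> B"
    "\<And>a y. a \<in> F \<Longrightarrow> y \<in> B \<Longrightarrow> a \<otimes> y \<notin> B"
proof -
  interpret group G by fact
  define \<epsilon> :: real where "\<epsilon> = 1 / (real (card F) + 1)"
  have "\<epsilon> > 0" by (simp add: \<epsilon>_def add_nonneg_pos)
  with assms(3,4) have "finite F \<and> F \<subseteq> carrier G - {\<one>} \<and> \<epsilon> > 0" by blast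
  from assms(2)[unfolded P_FPP_def, THEN spec, THEN spec, THEN spec, THEN mp, OF this, of 2]
  obtain E Bp Bm where
    finE: "finite E" and E: "E \<subseteq> carrier G"
    and Bs_ball: "\<forall>t\<in>E. Bp t \<subseteq> carrier G \<and> Bm t \<subseteq> carrier G"
    and cardE: "card E \<ge> 2"
    and disj: "disjoint_family_on (\<lambda>(t, positive). if positive then Bp t else Bm t) (E \<times> UNIV)"
    and push_ball: "\<forall>t\<in>E. t <# (carrier G - Bm t) \<subseteq> Bp t"
    and few_ball: "\<forall>a\<in>F. real (card {(s, t). s \<in> E \<and> t \<in> E \<and>
                (a <# (Bp t \<union> Bm t)) \<inter> (Bp s \<union> Bm s) \<noteq> {}}) < \<epsilon> * real (card E)"
    by (elim exE conjE) (rule that)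
  note Bs = bspec[OF Bs_ball] and push = bspec[OF push_ball] and few = bspec[OF few_ball]
  define bad where "bad a = {t \<in> E. (a <# (Bp t \<union> Bm t)) \<inter> (Bp t \<union> Bm t) \<noteq> {}}" for a
  have bad_few: "real (card (bad a)) \<le> \<epsilon> * real (card E)" if "a \<in> F" for a
  proof -
    let ?R = "{(s, t). s \<in> E \<and> t \<in> E \<and> (a <# (Bp t \<union> Bm t)) \<inter> (Bp s \<union> Bm s) \<noteq> {}}"
    have "?R \<subseteq> E \<times> E" by auto
    then have "finite ?R" using finE by (meson finite_SigmaI finite_subset)
    moreover have "(\<lambda>t. (t, t)) ` bad a \<subseteq> ?R" by (auto simp: bad_def)
    ultimately have "card ((\<lambda>t. (t, t)) ` bad a) \<le> card ?R" by (rule card_mono)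
    moreover have "card ((\<lambda>t. (t, t)) ` bad a) = card (bad a)"
      by (intro card_image inj_onI) simp
    ultimately show ?thesis using few[OF that] by linarith
  qed
  have "real (card (\<Union>a\<in>F. bad a)) \<le> real (\<Sum>a\<in>F. card (bad a))"
    using card_UN_le[OF assms(3)] by (simp only: of_nat_le_iff)
  also have "\<dots> \<le> real (card F) * (\<epsilon> * real (card E))"
    using sum_bounded_above[of F "\<lambda>a. real (card (bad a))" "\<epsilon> * real (card E)"] bad_few by simp
  also have "\<dots> < real (card E)"
    using cardE by (simp add: \<epsilon>_def field_simps)
  finally have "card (\<Union>a\<in>F. bad a) < card E" by simp
  moreover have "finite (\<Union>a\<in>F. bad a)"
    using finE by (rule finite_subset[rotated]) (auto simp: bad_def)
  ultimately have "\<not> E \<subseteq> (\<Union>a\<in>F. bad a)"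
    using card_mono[OF \<open>finite (\<Union>a\<in>F. bad a)\<close>, of E] by linarith
  then obtain t where t: "t \<in> E" "\<And>a. a \<in> F \<Longrightarrow> t \<notin> bad a" by blast
  define B where "B = Bp t \<union> Bm t"
  have "\<not> E \<subseteq> {t}" using cardE card_mono[of "{t}" E] by auto
  then obtain c where c: "c \<in> E" "c \<noteq> t" by blast
  have sep: "(if e then Bp x else Bm x) \<inter> (if e' then Bp y else Bm y) = {}"
    if "x \<in> E" "y \<in> E" "(x, e) \<noteq> (y, e')" for x y e e'
    using disjoint_family_onD[OF disj, of "(x, e)" "(y, e')"] that by (simp only: prod.case) simp
  have tt: "Bp t \<inter> Bm t = {}"
    using sep[OF t(1) t(1), of True False] by simp
  have ct: "Bp c \<inter> B = {}" "Bm c \<inter> B = {}"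
    using sep[OF c(1) t(1), of True True] sep[OF c(1) t(1), of True False]
      sep[OF c(1) t(1), of False True] sep[OF c(1) t(1), of False False] c(2)
    by (simp_all add: B_def Int_Un_distrib)
  \<comment> \<open>If \<open>B\<close> were everything, both sets of \<open>c\<close> would be empty, and \<open>c\<close> would move the whole group
     into the empty set.\<close>
  have "\<exists>p\<in>carrier G. p \<notin> B"
  proof (rule ccontr)
    assume "\<not> ?thesis"
    then have "Bp c = {}" "Bm c = {}" using ct Bs[OF c(1)] by blast+
    then show False using push[OF c(1)] by (auto simp: l_coset_def)
  qed
  then obtain p where "p \<in> carrier G" "p \<notin> B" by blast
  moreover have "t [^] k \<otimes> y \<in> B" if "k \<noteq> 0" "y \<in> carrier G" "y \<notin> B" for k :: int and y
    using ping_pong_power[of t "Bp t" "Bm t" k y] Bs[OF t(1)] tt push[OF t(1)] E t(1) that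
    by (auto simp: B_def)
  moreover have "a \<otimes> y \<notin> B" if "a \<in> F" "y \<in> B" for a y
    using t(2)[OF that(1)] t(1) that(2) by (auto simp: bad_def B_def l_coset_def)
  ultimately show ?thesis using that t(1) E by blast
qed

section \<open>Generating sets of large girth\<close>

lemma (in group) generate_sandwich:
  assumes S: "S \<subseteq> carrier G" and t: "t \<in> carrier G"
  shows "generate G S \<subseteq> generate G (insert t ((\<lambda>s. t [^] int (m s) \<otimes> s \<otimes> t [^] int (m s)) ` (S - {\<one>})))"
    (is "_ \<subseteq> generate G ?T")
proof -
  have T: "?T \<subseteq> carrier G" using S t by auto
  interpret H: subgroup "generate G ?T" G using generate_is_subgroup[OF T] .
  have "s \<in> generate G ?T" if s: "s \<in> S" for s
  proof (cases "s = \<one>")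
    case True
    then show ?thesis by simp
  next
    case False
    let ?u = "t [^] int (m s)"
    have u: "?u \<in> generate G ?T"
      using subgroup_int_pow_closed[OF H.subgroup_axioms generate.incl[of t]] by simp
    have h: "?u \<otimes> s \<otimes> ?u \<in> generate G ?T"
      using s False by (intro generate.incl) auto
    have iu: "inv ?u \<in> generate G ?T"
      using u by (rule H.m_inv_closed)
    have "inv ?u \<otimes> (?u \<otimes> s \<otimes> ?u) \<otimes> inv ?u \<in> generate G ?T"
      by (rule H.m_closed[OF H.m_closed[OF iu h] iu])
    moreover have "inv ?u \<otimes> (?u \<otimes> s \<otimes> ?u) \<otimes> inv ?u = s"
    proof -
      have cancel: "inv x \<otimes> (x \<otimes> y \<otimes> x) \<otimes> inv x = y"
        if x: "x \<in> carrier G" and y: "y \<in> carrier G" for x y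
      proof -
        have "inv x \<otimes> (x \<otimes> y \<otimes> x) = y \<otimes> x"
          using x y by (simp add: m_assoc[symmetric])
        then show ?thesis using x y by (simp add: m_assoc)
      qed
      show ?thesis using s S t by (intro cancel) auto
    qed
    ultimately show ?thesis by (simp only:)
  qed
  then show ?thesis using generate_subgroup_incl[OF _ H.subgroup_axioms] by blast
qed

text \<open>If several \<open>s\<close> give the same generator \<open>h\<close>, any of them may serve as its \<open>mid h\<close>:
  different \<open>h\<close> still have different \<open>mid h\<close>, hence exponents more than \<open>N\<close> apart.\<close>

lemma large_girth_generating_set:
  fixes G (structure)
  assumes "finitely_generated_group G" "P_FPP G"
  obtains T where "finite_generating_set G T" "enat N \<le> girth_wrt G T"
proof -
  interpret group G using assms(1) by (simp add: finitely_generated_group_def)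
  obtain S where S: "finite S" "S \<subseteq> carrier G" "generate G S = carrier G"
    using assms(1) by (auto simp: finitely_generated_group_def finite_generating_set_def)
  define F where "F = S - {\<one>}"
  have F: "finite F" "F \<subseteq> carrier G - {\<one>}" using S by (auto simp: F_def)
  obtain t B p where t: "t \<in> carrier G" and p: "p \<in> carrier G" "p \<notin> B"
    and into: "\<And>k::int. \<And>y. k \<noteq> 0 \<Longrightarrow> y \<in> carrier G \<Longrightarrow> y \<notin> B \<Longrightarrow> t [^] k \<otimes> y \<in> B"
    and out: "\<And>a y. a \<in> F \<Longrightarrow> y \<in> B \<Longrightarrow> a \<otimes> y \<notin> B"
    using P_FPP_displacing_element[OF is_group assms(2) F] by metis
  obtain ix :: "'a \<Rightarrow> nat" where ix: "inj_on ix F"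
    using finite_imp_inj_to_nat_seg[OF F(1)] by blast
  \<comment> \<open>Distinct positive multiples of \<open>N + 1\<close> exceed \<open>N\<close> and have differences exceeding \<open>N\<close>.\<close>
  define m where "m s = (ix s + 1) * (N + 1)" for s
  define g where "g = (\<lambda>s. t [^] int (m s) \<otimes> s \<otimes> t [^] int (m s))"
  define mid where "mid = inv_into F g"
  have mid: "mid h \<in> F" "g (mid h) = h" if "h \<in> g ` F" for h
    using that by (auto simp: mid_def inv_into_into f_inv_into_f)
  have gap: "int N < \<bar>int (m s) - int (m s')\<bar>" if "s \<in> F" "s' \<in> F" "s \<noteq> s'" for s s'
  proof -
    have "ix s \<noteq> ix s'" using ix that by (auto dest: inj_onD)
    then have "1 \<le> \<bar>int (ix s) - int (ix s')\<bar>" by simp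
    then have "1 * (int N + 1) \<le> \<bar>int (ix s) - int (ix s')\<bar> * (int N + 1)"
      by (intro mult_right_mono) auto
    also have "\<dots> = \<bar>(int (ix s) - int (ix s')) * (int N + 1)\<bar>" by (simp add: abs_mult)
    also have "(int (ix s) - int (ix s')) * (int N + 1) = int (m s) - int (m s')"
      by (simp add: m_def algebra_simps)
    finally show ?thesis by simp
  qed
  interpret short_word_ping_pong G t p B "g ` F" mid "\<lambda>h. m (mid h)" N
  proof unfold_locales
    fix h assume h: "h \<in> g ` F"
    show "mid h \<in> carrier G" using mid(1)[OF h] F by auto
    show "h = t [^] int (m (mid h)) \<otimes> mid h \<otimes> t [^] int (m (mid h))"
      using mid(2)[OF h] by (simp only: g_def)
    show "N < m (mid h)" by (simp add: m_def)
    fix h' assume "h' \<in> g ` F" "h \<noteq> h'"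
    then show "int N < \<bar>int (m (mid h)) - int (m (mid h'))\<bar>"
      using gap mid h by metis
  qed (use t p into out mid in auto)
  have T: "insert t (g ` F) \<subseteq> carrier G" using t F by (auto simp: g_def)
  have "generate G S \<subseteq> generate G (insert t (g ` F))"
    using generate_sandwich[OF S(2) t, of m] by (simp only: F_def g_def)
  then have "generate G (insert t (g ` F)) = carrier G"
    using S(3) generate_incl[OF T] by auto
  then have "finite_generating_set G (insert t (g ` F))"
    using T F(1) by (simp add: finite_generating_set_def)
  moreover have "enat N \<le> girth_wrt G (insert t (g ` F))"
    unfolding girth_wrt_def
  proof (rule INF_greatest)
    fix w assume "w \<in> {w \<in> words_over (insert t (g ` F)). w \<noteq> [] \<and> cyclically_reduced w \<and>
                        word_value G w = \<one>}"
    then have "\<not> length w \<le> N"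
      using reduced_word_nontrivial[of w] by (auto simp: cyclically_reduced_def)
    then show "enat N \<le> enat (length w)" by simp
  qed
  ultimately show ?thesis using that by blast
qed

theorem theorem2p12:
  fixes G :: "('a, 'b) monoid_scheme"
  assumes "finitely_generated_group G"
    and "P_FPP G"
  shows "girth G = \<infinity>"
proof -
  have "enat N \<le> girth G" for N
  proof -
    obtain T where "finite_generating_set G T" "enat N \<le> girth_wrt G T"
      using large_girth_generating_set[OF assms] .
    then show ?thesis unfolding girth_def by (intro SUP_upper2[of T]) auto
  qed
  then show ?thesis
    by (metis Suc_ile_eq enat.exhaust linorder_not_le)
qed

end
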